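(* Let $P$ be a finite pure poset. Then the chain polytope $D_P$ has the integer decomposition property. Consequently, $\mathbb{K}[C_P]$ is the same as the Ehrhart ring $A(D_P)$ (under the identification, described in the context, that omits the grading variable $y$).
   Context: $\mathbb{K}$ is a field, $\mathbb{N}_0=\{0,1,2,\dots\}$. The length of a chain $C$ in a finite poset is $|C|-1$. A finite poset $P$ is pure of rank $r$ if every maximal chain of $P$ has length $r$. To each maximal chain $C: x_0<x_1<\cdots<x_r$ of $P$ associate the monomial $x_C=x_0x_1\cdots x_r$ in the polynomial ring $\mathbb{K}[x : x\in P]$. The chain algebra $\mathbb{K}[C_P]$ is the $\mathbb{K}$-subalgebra generated by all $x_C$, with $C$ a maximal chain of $P$. The chain polytope $D_P\subset\mathbb{R}^P$ is the convex hull of the characteristic functions $\chi_C:P\to\mathbb{R}$ of all maximal chains $C$ of $P$ ($\chi_C(x)=1$ if $x\in C$ and $0$ otherwise). A lattice polytope $D\subset\mathbb{R}^d$ has the integer decomposition property if for all integers $k>0$ and all $\alpha\in kD\cap\mathbb{Z}^d$ there exist $\beta_1,\ldots,\beta_k\in D\cap\mathbb{Z}^d$ with $\alpha=\beta_1+\cdots+\beta_k$. The Ehrhart ring of $D$ is $A(D)=\mathbb{K}[x_1^{a_1}\cdots x_d^{a_d}y^k : (a_1,\ldots,a_d)\in kD\cap\mathbb{Z}^d,\ k\in\mathbb{N}_0]\subseteq\mathbb{K}[x_1,\dots,x_d,y]$. All points of $D_P$ lie on the affine hyperplane $\sum_{x\in P}f(x)=r+1$, so the variable $y$ may be omitted: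 $\mathbb{K}[C_P]$ is identified with the $\mathbb{K}$-subalgebra of $\mathbb{K}[x,y : x\in P]$ generated by the monomials $x_Cy$, via $x_C\mapsto x_Cy$. *)

theory Defs
  imports "HOL-Analysis.Analysis" "HOL-Library.Poly_Mapping"
begin

text \<open>
  A finite (nonempty) poset is a type \<open>'p\<close> of class \<open>{finite, order}\<close>, and
  \<open>\<real>\<^sup>P\<close> is \<open>real ^ 'p\<close>.
\<close>

subsection \<open>Chains and purity\<close>

definition maximal_chains :: "'p::order set set" where
  "maximal_chains = {C. pred_on.maxchain UNIV (<) C}"

definition chain_length :: "'p set \<Rightarrow> int" where
  "chain_length C = int (card C) - 1"

definition pure_poset :: "'p::{finite,order} itself \<Rightarrow> nat \<Rightarrow> bool" where
  "pure_poset _ r \<longleftrightarrow> (\<forall>C \<in> (maximal_chains :: 'p set set). chain_length C = int r)"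

subsection \<open>Lattice polytopes\<close>

definition lattice_points :: "(real ^ 'd) set" where
  "lattice_points = {v. \<forall>i. v $ i \<in> \<int>}"

definition dilate :: "nat \<Rightarrow> (real ^ 'd) set \<Rightarrow> (real ^ 'd) set" where
  "dilate k D = (\<lambda>v. real k *\<^sub>R v) ` D"

definition lattice_polytope :: "(real ^ 'd) set \<Rightarrow> bool" where
  "lattice_polytope D \<longleftrightarrow> (\<exists>V. finite V \<and> V \<subseteq> lattice_points \<and> D = convex hull V)"

definition integer_decomposition_property :: "(real ^ 'd) set \<Rightarrow> bool" where
  "integer_decomposition_property D \<longleftrightarrow> lattice_polytope D \<and>
     (\<forall>k>0. \<forall>\<alpha> \<in> dilate k D \<inter> lattice_points.
        \<exists>\<beta> :: nat \<Rightarrow> real ^ 'd.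
          (\<forall>i\<in>{1..k}. \<beta> i \<in> D \<inter> lattice_points) \<and> \<alpha> = (\<Sum>i=1..k. \<beta> i))"

definition chain_polytope :: "(real ^ 'p::{finite,order}) set" where
  "chain_polytope = convex hull ((\<lambda>C. \<chi> x. indicator C x) ` maximal_chains)"

subsection \<open>Polynomial rings and subalgebras\<close>

text \<open>
  The polynomial ring over \<open>'k\<close> in variables indexed by \<open>'v\<close>: finitely supported
  maps from exponent vectors to coefficients, with the convolution product of
  \<open>Poly_Mapping\<close>.
\<close>
type_synonym ('v, 'k) mpoly = "('v \<Rightarrow>\<^sub>0 nat) \<Rightarrow>\<^sub>0 'k"

definition Const :: "'k::field \<Rightarrow> ('v, 'k) mpoly" where
  "Const c = Poly_Mapping.single 0 c"

definition Var :: "'v \<Rightarrow> ('v, 'k::field) mpoly" where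
  "Var v = Poly_Mapping.single (Poly_Mapping.single v 1) 1"

text \<open>Scalar multiplication by \<open>c\<close> is multiplication by \<open>Const c\<close>.\<close>
definition is_subalgebra :: "('v, 'k::field) mpoly set \<Rightarrow> bool" where
  "is_subalgebra A \<longleftrightarrow> (\<forall>c. Const c \<in> A) \<and>
     (\<forall>f\<in>A. \<forall>g\<in>A. f + g \<in> A \<and> f * g \<in> A)"

definition generated_subalgebra :: "('v, 'k::field) mpoly set \<Rightarrow> ('v, 'k) mpoly set" where
  "generated_subalgebra G = is_subalgebra hull G"

definition algebra_iso_on ::
  "('v, 'k::field) mpoly set \<Rightarrow> ('w, 'k) mpoly set \<Rightarrow> (('v, 'k) mpoly \<Rightarrow> ('w, 'k) mpoly) \<Rightarrow> bool" where
  "algebra_iso_on A B \<phi> \<longleftrightarrow> bij_betw \<phi> A B \<and> (\<forall>c. \<phi> (Const c) = Const c) \<and>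
     (\<forall>f\<in>A. \<forall>g\<in>A. \<phi> (f + g) = \<phi> f + \<phi> g \<and> \<phi> (f * g) = \<phi> f * \<phi> g)"

subsection \<open>Chain algebra and Ehrhart ring\<close>

definition chain_monomial :: "'p set \<Rightarrow> ('p, 'k::field) mpoly" where
  "chain_monomial C = (\<Prod>x\<in>C. Var x)"

definition chain_algebra :: "('p::{finite,order}, 'k::field) mpoly set" where
  "chain_algebra = generated_subalgebra (chain_monomial ` maximal_chains)"

text \<open>The variables of \<open>K[x\<^sub>1,\<dots>,x\<^sub>d,y]\<close>; \<open>Grading\<close> stands for \<open>y\<close>.\<close>
datatype 'd graded_var = Coord 'd | Grading

definition graded_chain_monomial :: "'p set \<Rightarrow> ('p graded_var, 'k::field) mpoly" where
  "graded_chain_monomial C = (\<Prod>x\<in>C. Var (Coord x)) * Var Grading"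

definition graded_chain_algebra :: "('p::{finite,order} graded_var, 'k::field) mpoly set" where
  "graded_chain_algebra = generated_subalgebra (graded_chain_monomial ` maximal_chains)"

text \<open>
  The Ehrhart ring lives in a polynomial ring rather than a Laurent polynomial ring, so
  exponents are natural numbers. The definition is meant for polytopes in the nonnegative
  orthant, where every lattice point of a dilate has natural coordinates.
\<close>
definition ehrhart_ring :: "(real ^ 'd) set \<Rightarrow> ('d graded_var, 'k::field) mpoly set" where
  "ehrhart_ring D = generated_subalgebra
     {(\<Prod>i\<in>UNIV. Var (Coord i) ^ a i) * Var Grading ^ k | (a :: 'd \<Rightarrow> nat) k.
        (\<chi> i. real (a i)) \<in> dilate k D}"

end

theory Submission
  imports Defs
begin

text \<open>
  Replace every element \<open>x\<close> of the poset by \<open>\<alpha> x\<close> incomparable copies, where \<open>\<alpha>\<close> is an integer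
  point of \<open>kD\<^sub>P\<close>. Every maximal chain meets an antichain at most once, so antichains of the blown-up
  poset have at most \<open>k\<close> elements, and Dilworth's theorem partitions it into \<open>k\<close> chains. There are
  \<open>k(r + 1)\<close> elements in total and a chain has at most \<open>r + 1\<close>, so each of the \<open>k\<close> chains has exactly
  \<open>r + 1\<close> elements, i.e. is maximal. This decomposes \<open>\<alpha>\<close> into \<open>k\<close> characteristic functions.
  The identification of the chain algebra with its graded version is the linear map that sends
  a monomial \<open>m\<close> to \<open>m\<close> times \<open>y\<close> to the power \<open>deg m div (r + 1)\<close>; it is multiplicative on the
  polynomials all of whose monomials have degree divisible by \<open>r + 1\<close>.
\<close>

subsection \<open>Dilworth's theorem\<close>

theorem dilworth:
  assumes "transp R" "irreflp R" "finite A"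
    and "\<And>B. B \<subseteq> A \<Longrightarrow> \<forall>x\<in>B. \<forall>y\<in>B. \<not> R x y \<Longrightarrow> card B \<le> k"
  shows "\<exists>c :: 'a \<Rightarrow> nat. (\<forall>x\<in>A. c x < k) \<and> (\<forall>i. totalp_on {x \<in> A. c x = i} R)"
  using assms(3,4)
  \<comment> \<open>Galvin's induction: remove a maximal element \<open>a\<close>, colour the rest with \<open>w\<close> colours where \<open>w\<close>
    is its width, and let \<open>m i\<close> be the top element of colour \<open>i\<close> lying in an antichain of size \<open>w\<close>.
    The \<open>m i\<close> form an antichain. Either \<open>a\<close> extends it, or \<open>a\<close> lies above some \<open>m i\<close> and removing
    \<open>a\<close> with the part of colour \<open>i\<close> up to \<open>m i\<close> lowers the width.\<close>
proof (induction A arbitrary: k rule: finite_psubset_induct)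
  case (psubset A)
  let ?anti = "\<lambda>B. \<forall>x\<in>B. \<forall>y\<in>B. \<not> R x y"
  have tr: "R x z" if "R x y" "R y z" for x y z
    using transpD[OF assms(1)] that .
  show ?case
  proof (cases "A = {}")
    case True
    then show ?thesis by (auto simp: totalp_on_def)
  next
    case False
    have ex_max: "\<exists>m\<in>S. \<forall>x\<in>S. \<not> R m x" if "finite S" "S \<noteq> {}" for S
      using Finite_Set.bex_max_element[of S R] that assms(1,2)
      by (metis asympI asymp_on_subset irreflpD subset_UNIV tr transp_on_subset)
    obtain a where a: "a \<in> A" "\<And>x. x \<in> A \<Longrightarrow> \<not> R a x"
      using ex_max[OF psubset.hyps(1) False] by blast
    define A' where "A' = A - {a}"
    have A': "A' \<subset> A" "finite A'" "A = insert a A'" "a \<notin> A'"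
      using a psubset.hyps by (auto simp: A'_def)
    \<comment> \<open>The width of \<open>A'\<close>. The empty antichain makes the maximum range
      over a nonempty set, so \<open>w = 0\<close> is possible.\<close>
    define w where "w = Max (card ` {B. B \<subseteq> A' \<and> ?anti B})"
    have fin: "finite (card ` {B. B \<subseteq> A' \<and> ?anti B})"
      using A'(2) by auto
    have w_upper: "card B \<le> w" if "B \<subseteq> A'" "?anti B" for B
      unfolding w_def using that fin by (intro Max_ge) auto
    have "w \<in> card ` {B. B \<subseteq> A' \<and> ?anti B}"
      unfolding w_def using fin by (intro Max_in) auto
    then obtain W where W: "W \<subseteq> A'" "?anti W" "card W = w"
      by auto
    obtain c :: "'a \<Rightarrow> nat" where c: "\<And>x. x \<in> A' \<Longrightarrow> c x < w"
      "\<And>x y. x \<in> A' \<Longrightarrow> y \<in> A' \<Longrightarrow> c x = c y \<Longrightarrow> x \<noteq> y \<Longrightarrow> R x y \<or> R y x"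
      using psubset.IH[OF A'(1) w_upper] by (auto simp: totalp_on_def)
    \<comment> \<open>Comparability within a colour forbids two elements of an antichain to share
      one; with \<open>w\<close> elements, every colour occurs.\<close>
    have colours: "c ` B = {..<w}" if "B \<subseteq> A'" "?anti B" "card B = w" for B
    proof (rule card_subset_eq)
      have "inj_on c B"
      proof (rule inj_onI, rule ccontr)
        fix x y assume "x \<in> B" "y \<in> B" "c x = c y" "x \<noteq> y"
        with c(2)[of x y] that(1,2) show False by auto
      qed
      then show "card (c ` B) = card {..<w}"
        using that(3) by (simp add: card_image)
    qed (use c(1) that(1) in auto)
    define M where "M i = {x \<in> A'. c x = i \<and> (\<exists>B\<subseteq>A'. ?anti B \<and> card B = w \<and> x \<in> B)}" for i
    have "\<exists>x \<in> M i. \<forall>y \<in> M i. \<not> R x y" if "i < w" for i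
    proof -
      have "i \<in> c ` W"
        using colours[OF W] that by simp
      then obtain y where "y \<in> W" "c y = i"
        by blast
      then have "y \<in> M i"
        unfolding M_def using W by blast
      moreover have "finite (M i)"
        using A'(2) by (auto simp: M_def)
      ultimately show ?thesis
        using ex_max[of "M i"] by blast
    qed
    then obtain m where m: "\<And>i. i < w \<Longrightarrow> m i \<in> M i"
      "\<And>i y. i < w \<Longrightarrow> y \<in> M i \<Longrightarrow> \<not> R (m i) y"
      by metis
    have mA: "m i \<in> A'" "c (m i) = i" if "i < w" for i
      using m(1)[OF that] by (auto simp: M_def)
    \<comment> \<open>The element of colour \<open>i\<close> in \<open>B\<close> belongs to
      \<open>M i\<close>. Having the colour of \<open>m i\<close>, it is equal or comparable to
      \<open>m i\<close>, and it cannot lie above.\<close>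
    have below: "\<exists>y\<in>B. c y = i \<and> (y = m i \<or> R y (m i))"
      if "B \<subseteq> A'" "?anti B" "card B = w" "i < w" for B i
    proof -
      have "i \<in> c ` B"
        using colours[OF that(1-3)] that(4) by simp
      then obtain y where y: "y \<in> B" "c y = i"
        by blast
      then have "y \<in> M i"
        unfolding M_def using that by blast
      then have "\<not> R (m i) y"
        using m(2)[OF that(4)] by simp
      moreover have "y \<in> A'"
        using y that(1) by blast
      ultimately show ?thesis
        using y c(2)[of y "m i"] mA[OF that(4)] by metis
    qed
    \<comment> \<open>\<open>R (m i) (m j)\<close> would put the element of colour \<open>i\<close>
      in a maximum antichain through \<open>m j\<close> strictly below \<open>m j\<close>.\<close>
    have anti_m: "\<not> R (m i) (m j)" if i: "i < w" and j: "j < w" for i j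
    proof
      assume R: "R (m i) (m j)"
      obtain B where B: "B \<subseteq> A'" "?anti B" "card B = w" "m j \<in> B"
        using m(1)[OF j] by (auto simp: M_def)
      obtain y where "y \<in> B" "y = m i \<or> R y (m i)"
        using below[OF B(1-3) i] by blast
      then have "R y (m j)"
        using R tr[of y "m i" "m j"] by metis
      then show False
        using B(2,4) \<open>y \<in> B\<close> by blast
    qed
    show ?thesis
    proof (cases "\<exists>i<w. R (m i) a")
      case True
      then obtain i where i: "i < w" "R (m i) a" by blast
      define K where "K = insert a {z \<in> A'. c z = i \<and> (z = m i \<or> R z (m i))}"
      have K: "A - K \<subset> A" "A - K \<subseteq> A'"
        using a(1) by (auto simp: K_def A'_def)
      \<comment> \<open>An antichain of size \<open>w\<close> would contain an element of colour
        \<open>i\<close> at or below \<open>m i\<close>, hence an element of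
        \<open>K\<close>.\<close>
      have "card B \<le> w - 1" if B: "B \<subseteq> A - K" "?anti B" for B
      proof -
        have BA': "B \<subseteq> A'"
          using B(1) K(2) by (rule order_trans)
        have "card B \<noteq> w"
        proof
          assume "card B = w"
          then obtain y where "y \<in> B" "c y = i" "y = m i \<or> R y (m i)"
            using below[OF BA' B(2) _ i(1)] by blast
          then show False
            using B(1) BA' by (auto simp: K_def)
        qed
        moreover have "card B \<le> w"
          using w_upper[OF BA' B(2)] .
        ultimately show ?thesis by simp
      qed
      from psubset.IH[OF K(1) this] obtain c' :: "'a \<Rightarrow> nat" where
        c': "\<And>x. x \<in> A - K \<Longrightarrow> c' x < w - 1" "\<And>i. totalp_on {x \<in> A - K. c' x = i} R"
        by blast
      have "totalp_on K R"
      proof (rule totalp_onI)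
        have K_a: "z = a \<or> R z a \<and> z \<in> A' \<and> c z = i" if "z \<in> K" for z
          using that i tr[of z "m i" a] mA[OF i(1)] by (auto simp: K_def)
        fix x y assume "x \<in> K" "y \<in> K" "x \<noteq> y"
        with K_a[of x] K_a[of y] c(2)[of x y] show "R x y \<or> R y x"
          by metis
      qed
      \<comment> \<open>The rest uses only colours below \<open>w - 1\<close>, which leaves
        \<open>w - 1\<close> for the chain \<open>K\<close>; \<open>w\<close> is positive because
        \<open>i < w\<close>.\<close>
      define d where "d x = (if x \<in> K then w - 1 else c' x)" for x
      have "w \<le> k"
        using psubset.prems[of W] W A' by auto
      then have "d x < k" if "x \<in> A" for x
        using c'(1)[of x] that i(1) by (auto simp: d_def)
      moreover have "totalp_on {x \<in> A. d x = j} R" for j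
      proof (cases "j = w - 1")
        case True
        have "{x \<in> A. d x = j} \<subseteq> K"
        proof
          fix x assume x: "x \<in> {x \<in> A. d x = j}"
          show "x \<in> K"
          proof (rule ccontr)
            assume "x \<notin> K"
            then show False
              using x c'(1)[of x] True by (simp add: d_def)
          qed
        qed
        then show ?thesis
          using \<open>totalp_on K R\<close> totalp_on_subset by blast
      next
        case False
        then have "{x \<in> A. d x = j} \<subseteq> {x \<in> A - K. c' x = j}"
          by (auto simp: d_def)
        then show ?thesis
          using c'(2) totalp_on_subset by blast
      qed
      ultimately show ?thesis by blast
    next
      case False
      \<comment> \<open>Nothing in \<open>A\<close> lies above \<open>a\<close> and no
        \<open>m i\<close> lies below it, so \<open>a\<close> enlarges the antichain of the
        \<open>m i\<close> to \<open>w + 1\<close> elements. This leaves room for a new colour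
        \<open>w\<close>, given to \<open>a\<close> alone.\<close>
      have "inj_on m {..<w}"
        by (rule inj_on_inverseI[of _ c]) (simp add: mA)
      then have "card (insert a (m ` {..<w})) = Suc w"
        using mA(1) A'(4) by (subst card_insert_disjoint) (auto simp: card_image)
      moreover have "?anti (insert a (m ` {..<w}))"
        using False anti_m a mA(1) A'(3) by auto
      moreover have "insert a (m ` {..<w}) \<subseteq> A"
        using mA(1) A'(3) by auto
      ultimately have "Suc w \<le> k"
        using psubset.prems by metis
      define d where "d = c(a := w)"
      have "d x < k" if "x \<in> A" for x
        using c(1)[of x] that A'(3) \<open>Suc w \<le> k\<close> by (cases "x = a") (auto simp: d_def)
      moreover have "totalp_on {x \<in> A. d x = j} R" for j
      proof (rule totalp_onI)
        fix x y assume "x \<in> {x \<in> A. d x = j}" "y \<in> {x \<in> A. d x = j}" "x \<noteq> y"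
        with c(1)[of x] c(1)[of y] c(2)[of x y] A'(3) show "R x y \<or> R y x"
          by (auto simp: d_def split: if_splits)
      qed
      ultimately show ?thesis by blast
    qed
  qed
qed

subsection \<open>Decomposing lattice points into maximal chains\<close>

lemma mem_maximal_chains_iff:
  "C \<in> maximal_chains \<longleftrightarrow> totalp_on C (<) \<and> (\<forall>D. totalp_on D (<) \<longrightarrow> \<not> C \<subset> D)"
proof -
  have "pred_on.chain UNIV (<) D \<longleftrightarrow> totalp_on D (<)" for D :: "'a set"
    unfolding pred_on.chain_def totalp_on_def by auto
  then show ?thesis
    by (simp add: maximal_chains_def pred_on.maxchain_def)
qed

lemma ex_maximal_chain:
  fixes C :: "'p::{finite,order} set"
  assumes "totalp_on C (<)"
  shows "\<exists>M\<in>maximal_chains. C \<subseteq> M"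
proof -
  have "C \<in> {D. totalp_on D (<)}"
    using assms by simp
  from finite_has_maximal2[OF finite this] obtain M where M: "totalp_on M (<)" "C \<subseteq> M"
    "\<And>D. totalp_on D (<) \<Longrightarrow> M \<subseteq> D \<Longrightarrow> M = D"
    by blast
  then have "M \<in> maximal_chains"
    unfolding mem_maximal_chains_iff using M(3) by (metis psubset_eq)
  with M(2) show ?thesis by blast
qed

context
  fixes r :: nat
  assumes pure: "pure_poset TYPE('p::{finite,order}) r"
begin

lemma card_maximal_chain: "C \<in> maximal_chains \<Longrightarrow> card C = Suc r" for C :: "'p set"
  using pure by (force simp: pure_poset_def chain_length_def)

lemma card_chain_le:
  fixes C :: "'p set"
  assumes "totalp_on C (<)"
  shows "card C \<le> Suc r"
proof -
  obtain M where "M \<in> maximal_chains" "C \<subseteq> M"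
    using ex_maximal_chain[OF assms] by blast
  then show ?thesis
    using card_mono[of M C] card_maximal_chain[of M] by simp
qed

lemma maximal_chainI:
  fixes C :: "'p set"
  assumes "totalp_on C (<)" "card C = Suc r"
  shows "C \<in> maximal_chains"
proof -
  obtain M where "M \<in> maximal_chains" "C \<subseteq> M"
    using ex_maximal_chain[OF assms(1)] by blast
  then show ?thesis
    using card_subset_eq[of M C] card_maximal_chain[of M] assms(2) by simp
qed

end

lemma chain_polytope_le:
  fixes A :: "'p::{finite,order} set"
  assumes "\<And>C :: 'p set. C \<in> maximal_chains \<Longrightarrow> s * real (card (A \<inter> C)) \<le> b" "v \<in> chain_polytope"
  shows "s * (\<Sum>x\<in>A. v $ x) \<le> b"
proof -
  define w :: "(real, 'p) vec" where "w = (\<chi> x. s * indicator A x)"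
  have inner: "w \<bullet> v = s * (\<Sum>x\<in>A. v $ x)" for v
    unfolding inner_vec_def w_def sum_distrib_left
    by (rule sum.mono_neutral_cong_right) (auto simp: indicator_def)
  have "chain_polytope \<subseteq> {v. w \<bullet> v \<le> b}"
    unfolding chain_polytope_def
  proof (rule hull_minimal)
    show "(\<lambda>C. \<chi> x. indicator C x) ` maximal_chains \<subseteq> {v. w \<bullet> v \<le> b}"
      using assms(1) by (auto simp: inner indicator_def sum.If_cases)
  qed (rule convex_halfspace_le)
  then show ?thesis
    using assms(2) inner by auto
qed

lemma chain_polytope_nonneg:
  "0 \<le> v $ x" if "v \<in> chain_polytope" for v :: "real ^ 'p::{finite,order}"
  using chain_polytope_le[of "-1" "{x}" 0 v] that by simp

lemma chain_polytope_antichain: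
  fixes v :: "real ^ 'p::{finite,order}"
  assumes "v \<in> chain_polytope" "\<forall>x\<in>A. \<forall>y\<in>A. \<not> x < y"
  shows "(\<Sum>x\<in>A. v $ x) \<le> 1"
proof -
  have "card (A \<inter> C) \<le> 1" if "C \<in> maximal_chains" for C
  proof -
    have "x = y" if "x \<in> A \<inter> C" "y \<in> A \<inter> C" for x y
      using that \<open>C \<in> maximal_chains\<close> assms(2) unfolding mem_maximal_chains_iff totalp_on_def
      by (metis IntD1 IntD2)
    then show ?thesis
      by (simp add: card_le_Suc0_iff_eq)
  qed
  then show ?thesis
    using chain_polytope_le[of 1 A 1 v] assms(1) by simp
qed

lemma chain_polytope_sum:
  fixes v :: "real ^ 'p::{finite,order}"
  assumes "pure_poset TYPE('p) r" "v \<in> chain_polytope"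
  shows "(\<Sum>x\<in>UNIV. v $ x) = real (Suc r)"
  using chain_polytope_le[of 1 UNIV "real (Suc r)" v] chain_polytope_le[of "-1" UNIV "- real (Suc r)" v]
    card_maximal_chain[OF assms(1)] assms(2) by simp

lemma indicator_mem_chain_polytope:
  "C \<in> maximal_chains \<Longrightarrow> (\<chi> x. indicator C x) \<in> chain_polytope"
  unfolding chain_polytope_def by (intro hull_inc imageI)

theorem chain_decomposition:
  fixes a :: "'p::{finite,order} \<Rightarrow> nat"
  assumes pure: "pure_poset TYPE('p) r" and a: "(\<chi> x. real (a x)) \<in> dilate k chain_polytope"
  obtains C where "\<And>i. i < k \<Longrightarrow> C i \<in> maximal_chains" "\<And>x. a x = (\<Sum>i<k. indicator (C i) x)"
proof -
  obtain v where v: "v \<in> chain_polytope" and "(\<chi> x. real (a x)) = real k *\<^sub>R v"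
    using a by (auto simp: dilate_def)
  then have a_eq: "real (a x) = real k * v $ x" for x
    by (metis vec_lambda_beta vector_scaleR_component real_scaleR_def)
  have antichain: "(\<Sum>x\<in>A. a x) \<le> k" if "\<forall>x\<in>A. \<forall>y\<in>A. \<not> x < y" for A
  proof -
    have "real (\<Sum>x\<in>A. a x) = real k * (\<Sum>x\<in>A. v $ x)"
      by (simp add: a_eq sum_distrib_left)
    also have "\<dots> \<le> real k"
      using chain_polytope_antichain[OF v that] by (simp add: mult_left_le)
    finally show ?thesis by (simp only: of_nat_le_iff)
  qed
  have "real (\<Sum>x\<in>UNIV. a x) = real (k * Suc r)"
    using chain_polytope_sum[OF pure v] by (simp add: a_eq distrib_left flip: sum_distrib_left)
  then have sum_a: "(\<Sum>x\<in>UNIV. a x) = k * Suc r"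
    by (simp only: of_nat_eq_iff)
  define Q where "Q = (SIGMA x:UNIV. {..<a x})"
  have "finite Q"
    by (simp add: Q_def)
  define R :: "'p \<times> nat \<Rightarrow> 'p \<times> nat \<Rightarrow> bool" where "R p q \<longleftrightarrow> fst p < fst q" for p q
  have "card B \<le> k" if B: "B \<subseteq> Q" "\<forall>p\<in>B. \<forall>q\<in>B. \<not> R p q" for B
  proof -
    have "B \<subseteq> (SIGMA x:fst ` B. {..<a x})"
      using B(1) by (force simp: Q_def)
    then have "card B \<le> card (SIGMA x:fst ` B. {..<a x})"
      by (intro card_mono) auto
    also have "\<dots> \<le> k"
      using antichain[of "fst ` B"] B(2) by (simp add: R_def)
    finally show ?thesis .
  qed
  moreover have "transp R" "irreflp R"
    by (auto simp: R_def intro!: transpI irreflpI)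
  ultimately obtain c :: "'p \<times> nat \<Rightarrow> nat" where c: "\<And>p. p \<in> Q \<Longrightarrow> c p < k"
    "\<And>i. totalp_on {p \<in> Q. c p = i} R"
    using dilworth[of R Q k] \<open>finite Q\<close> by blast
  define L where "L i = {p \<in> Q. c p = i}" for i
  have inj: "inj_on fst (L i)" for i
    using c(2)[of i] by (auto simp: L_def totalp_on_def R_def inj_on_def)
  have chain: "totalp_on (fst ` L i) (<)" for i
    using c(2)[of i] by (fastforce simp: L_def totalp_on_def R_def)
  have "(\<Sum>i<k. card (L i)) = card Q"
    using sum.group[OF \<open>finite Q\<close>, of "{..<k}" c "\<lambda>_. 1 :: nat"] c(1)
    by (simp add: L_def image_subset_iff)
  also have "\<dots> = (\<Sum>i<k. Suc r)"
    by (simp add: Q_def sum_a)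
  finally have "card (L i) = Suc r" if "i < k" for i
    using sum_mono_inv[of "\<lambda>i. card (L i)" "{..<k}" "\<lambda>_. Suc r" i] that
      card_chain_le[OF pure chain] by (simp add: card_image[OF inj])
  then have max: "fst ` L i \<in> maximal_chains" if "i < k" for i
    using maximal_chainI[OF pure chain] that by (simp add: card_image[OF inj])
  have "a x = (\<Sum>i<k. indicator (fst ` L i) x)" for x
  proof -
    have fibre: "card {p \<in> {x} \<times> {..<a x}. c p = i} = indicator (fst ` L i) x" for i
    proof -
      have "{p \<in> {x} \<times> {..<a x}. c p = i} = {p \<in> L i. fst p = x}"
        by (auto simp: L_def Q_def)
      moreover have "card {p \<in> L i. fst p = x} = card (fst ` {p \<in> L i. fst p = x})"
        by (rule card_image[symmetric]) (rule inj_on_subset[OF inj], auto)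
      moreover have "fst ` {p \<in> L i. fst p = x} = (if x \<in> fst ` L i then {x} else {})"
        by force
      ultimately show ?thesis by simp
    qed
    have "a x = card ({x} \<times> {..<a x})"
      by simp
    also have "\<dots> = (\<Sum>i<k. card {p \<in> {x} \<times> {..<a x}. c p = i})"
      using sum.group[of "{x} \<times> {..<a x}" "{..<k}" c "\<lambda>_. 1 :: nat"] c(1)
      by (simp add: Q_def image_subset_iff)
    finally show ?thesis
      by (simp only: fibre)
  qed
  with max show thesis
    by (rule that)
qed

lemma integer_decomposition_property_chain_polytope:
  assumes pure: "pure_poset TYPE('p::{finite,order}) r"
  shows "integer_decomposition_property (chain_polytope :: (real ^ 'p::{finite,order}) set)"
  unfolding integer_decomposition_property_def
proof (intro conjI allI impI ballI)
  have indicator_lattice: "(\<chi> x. indicator C x) \<in> lattice_points" for C :: "'p set"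
    by (simp add: lattice_points_def indicator_def)
  then show "lattice_polytope (chain_polytope :: (real, 'p) vec set)"
    unfolding lattice_polytope_def chain_polytope_def by (intro exI conjI) auto
  fix k :: nat and \<alpha> :: "(real, 'p) vec"
  assume \<alpha>: "\<alpha> \<in> dilate k chain_polytope \<inter> lattice_points"
  define a where "a x = nat \<lfloor>\<alpha> $ x\<rfloor>" for x
  have "0 \<le> \<alpha> $ x" for x
  proof -
    obtain v where "v \<in> chain_polytope" "\<alpha> = real k *\<^sub>R v"
      using \<alpha> by (auto simp: dilate_def)
    then show ?thesis
      using chain_polytope_nonneg[of v x] by simp
  qed
  moreover have "\<alpha> $ x \<in> \<int>" for x
    using \<alpha> by (simp add: lattice_points_def)
  ultimately have a: "real (a x) = \<alpha> $ x" for x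
    by (simp add: a_def)
  then have "(\<chi> x. real (a x)) = \<alpha>"
    by (simp add: vec_eq_iff)
  then obtain C where C: "\<And>i. i < k \<Longrightarrow> C i \<in> maximal_chains"
    "\<And>x. a x = (\<Sum>i<k. indicator (C i) x)"
    using chain_decomposition[OF pure, of a k] \<alpha> by auto
  define \<beta> :: "nat \<Rightarrow> (real, 'p) vec" where "\<beta> i = (\<chi> x. indicator (C (i - 1)) x)" for i
  have "\<alpha> $ x = (\<Sum>i=1..k. \<beta> i $ x)" for x
    using C(2)[of x] by (simp add: \<beta>_def sum.atLeast1_atMost_eq indicator_def flip: a)
  then have "\<alpha> = (\<Sum>i=1..k. \<beta> i)"
    by (simp add: vec_eq_iff)
  moreover have "\<forall>i\<in>{1..k}. \<beta> i \<in> chain_polytope \<inter> lattice_points"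
    using C(1) indicator_lattice by (auto simp: \<beta>_def intro!: indicator_mem_chain_polytope)
  ultimately show "\<exists>\<beta>. (\<forall>i\<in>{1..k}. \<beta> i \<in> chain_polytope \<inter> lattice_points) \<and> \<alpha> = (\<Sum>i=1..k. \<beta> i)"
    by blast
qed

subsection \<open>Subalgebras generated by monomials\<close>

lemma is_subalgebra_generated: "is_subalgebra (generated_subalgebra G)"
  unfolding generated_subalgebra_def
  by (rule hull_in) (auto simp: is_subalgebra_def)

lemma generated_subalgebra_subset:
  assumes "G \<subseteq> B" "is_subalgebra B"
  shows "generated_subalgebra G \<subseteq> B"
  unfolding generated_subalgebra_def using assms by (rule hull_minimal)

lemma generator_in_generated: "g \<in> G \<Longrightarrow> g \<in> generated_subalgebra G"
  unfolding generated_subalgebra_def by (rule hull_inc)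

lemma is_subalgebra_prod:
  assumes "is_subalgebra A" "\<And>i. i \<in> I \<Longrightarrow> f i \<in> A"
  shows "(\<Prod>i\<in>I. f i) \<in> A"
  using assms(2)
proof (induction I rule: infinite_finite_induct)
  case (insert x F)
  then show ?case using assms(1) by (simp add: is_subalgebra_def)
qed (use assms(1) in \<open>simp_all add: is_subalgebra_def Const_def flip: single_one\<close>)

lemma prod_single:
  "(\<Prod>i\<in>I. Poly_Mapping.single (m i) (1 :: 'k::comm_semiring_1)) = Poly_Mapping.single (\<Sum>i\<in>I. m i) 1"
  by (induction I rule: infinite_finite_induct) (simp_all add: mult_single)

lemma poly_mapping_eq_sum_single:
  assumes "finite S" "Poly_Mapping.keys f \<subseteq> S"
  shows "f = (\<Sum>m\<in>S. Poly_Mapping.single m (Poly_Mapping.lookup f m))"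
proof (rule poly_mapping_eqI)
  fix n
  show "Poly_Mapping.lookup f n =
      Poly_Mapping.lookup (\<Sum>m\<in>S. Poly_Mapping.single m (Poly_Mapping.lookup f m)) n"
    using assms by (auto simp: lookup_sum lookup_single when_def in_keys_iff)
qed

definition map_exponents :: "('a \<Rightarrow> 'b) \<Rightarrow> ('a \<Rightarrow>\<^sub>0 'k::comm_monoid_add) \<Rightarrow> ('b \<Rightarrow>\<^sub>0 'k)" where
  "map_exponents h f = (\<Sum>m\<in>Poly_Mapping.keys f. Poly_Mapping.single (h m) (Poly_Mapping.lookup f m))"

lemma map_exponents_eq:
  assumes "finite S" "Poly_Mapping.keys f \<subseteq> S"
  shows "map_exponents h f = (\<Sum>m\<in>S. Poly_Mapping.single (h m) (Poly_Mapping.lookup f m))"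
  unfolding map_exponents_def
  by (rule sum.mono_neutral_left) (use assms in \<open>auto simp: in_keys_iff\<close>)

lemma map_exponents_single [simp]:
  "map_exponents h (Poly_Mapping.single m c) = Poly_Mapping.single (h m) c"
  by (subst map_exponents_eq[of "{m}"]) auto

lemma map_exponents_add:
  "map_exponents h (f + g) = map_exponents h f + map_exponents h g"
  using keys_add[of f g]
  by (simp add: map_exponents_eq[of "Poly_Mapping.keys f \<union> Poly_Mapping.keys g"]
      lookup_add single_add sum.distrib)

lemma map_exponents_sum:
  "map_exponents h (\<Sum>i\<in>I. f i) = (\<Sum>i\<in>I. map_exponents h (f i))"
  by (induction I rule: infinite_finite_induct)
    (simp_all add: map_exponents_add, simp_all add: map_exponents_def)

lemma map_exponents_mult:
  fixes f g :: "'a::comm_monoid_add \<Rightarrow>\<^sub>0 'k::comm_semiring_1"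
    and h :: "'a \<Rightarrow> 'b::comm_monoid_add"
  assumes "\<And>m n. m \<in> Poly_Mapping.keys f \<Longrightarrow> n \<in> Poly_Mapping.keys g \<Longrightarrow> h (m + n) = h m + h n"
  shows "map_exponents h (f * g) = map_exponents h f * map_exponents h g"
proof -
  let ?s = "\<lambda>f m. Poly_Mapping.single m (Poly_Mapping.lookup f m)"
  have "f * g = (\<Sum>m\<in>Poly_Mapping.keys f. ?s f m) * (\<Sum>n\<in>Poly_Mapping.keys g. ?s g n)"
    by (simp flip: poly_mapping_eq_sum_single)
  also have "map_exponents h \<dots> = map_exponents h f * map_exponents h g"
    unfolding map_exponents_def[of h f] map_exponents_def[of h g]
    using assms by (simp add: sum_product map_exponents_sum mult_single)
  finally show ?thesis .
qed

lemma lookup_map_exponents: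
  assumes "inj h"
  shows "Poly_Mapping.lookup (map_exponents h f) (h m) = Poly_Mapping.lookup f m"
  using assms
  by (auto simp: map_exponents_def lookup_sum lookup_single when_def inj_eq in_keys_iff
      cong: if_cong)

lemma inj_map_exponents: "inj h \<Longrightarrow> inj (map_exponents h)"
  by (rule injI, rule poly_mapping_eqI) (metis lookup_map_exponents)

definition total_degree :: "('v::finite \<Rightarrow>\<^sub>0 nat) \<Rightarrow> nat" where
  "total_degree m = (\<Sum>x\<in>UNIV. Poly_Mapping.lookup m x)"

definition graded_exponent :: "nat \<Rightarrow> ('v::finite \<Rightarrow>\<^sub>0 nat) \<Rightarrow> ('v graded_var \<Rightarrow>\<^sub>0 nat)" where
  "graded_exponent d m = (\<Sum>x\<in>UNIV. Poly_Mapping.single (Coord x) (Poly_Mapping.lookup m x))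
     + Poly_Mapping.single Grading (total_degree m div d)"

lemma total_degree_add: "total_degree (m + n) = total_degree m + total_degree n"
  by (simp add: total_degree_def lookup_add sum.distrib)

lemma total_degree_indicator: "total_degree (\<Sum>x\<in>C. Poly_Mapping.single x 1) = card C"
  for C :: "'v::finite set"
proof -
  have "total_degree (Poly_Mapping.single x 1) = 1" for x :: 'v
    by (simp add: total_degree_def lookup_single when_def)
  then show ?thesis
    by (induction C rule: infinite_finite_induct)
      (simp_all add: total_degree_add, simp add: total_degree_def)
qed

lemma graded_exponent_add:
  assumes "d dvd total_degree m" "d dvd total_degree n"
  shows "graded_exponent d (m + n) = graded_exponent d m + graded_exponent d n"
  using assms
  by (simp add: graded_exponent_def total_degree_add lookup_add single_add sum.distrib
      add_ac)

lemma lookup_graded_exponent_Coord: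
  "Poly_Mapping.lookup (graded_exponent d m) (Coord x) = Poly_Mapping.lookup m x"
  by (simp add: graded_exponent_def lookup_add lookup_sum lookup_single when_def)

lemma inj_graded_exponent: "inj (graded_exponent d)"
  by (rule injI, rule poly_mapping_eqI) (metis lookup_graded_exponent_Coord)

lemma chain_monomial_single:
  "chain_monomial C = Poly_Mapping.single (\<Sum>x\<in>C. Poly_Mapping.single x 1) 1"
  by (simp add: chain_monomial_def Var_def prod_single)

lemma graded_chain_monomial_single:
  "graded_chain_monomial C = Poly_Mapping.single
     ((\<Sum>x\<in>C. Poly_Mapping.single (Coord x) 1) + Poly_Mapping.single Grading 1) 1"
  by (simp add: graded_chain_monomial_def Var_def prod_single mult_single)

lemma graded_exponent_indicator:
  fixes C :: "'v::finite set"
  assumes "card C = d" "d > 0"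
  shows "graded_exponent d (\<Sum>x\<in>C. Poly_Mapping.single x 1) =
    (\<Sum>x\<in>C. Poly_Mapping.single (Coord x) 1) + Poly_Mapping.single Grading 1"
proof -
  have "Poly_Mapping.single (Coord x) (Poly_Mapping.lookup (\<Sum>y\<in>C. Poly_Mapping.single y 1) x) =
      (if x \<in> C then Poly_Mapping.single (Coord x) (1::nat) else 0)" for x
    by (simp add: lookup_sum lookup_single when_def)
  then show ?thesis
    using assms unfolding graded_exponent_def total_degree_indicator
    by (simp flip: sum.inter_restrict)
qed

lemma algebra_iso_on_generated:
  fixes \<phi> :: "('v, 'k::field) mpoly \<Rightarrow> ('w, 'k) mpoly"
  assumes A: "is_subalgebra A" "G \<subseteq> A"
    and "inj \<phi>" "\<And>c. \<phi> (Const c) = Const c" "\<And>f g. \<phi> (f + g) = \<phi> f + \<phi> g"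
    and mult: "\<And>f g. f \<in> A \<Longrightarrow> g \<in> A \<Longrightarrow> \<phi> (f * g) = \<phi> f * \<phi> g"
  shows "algebra_iso_on (generated_subalgebra G) (generated_subalgebra (\<phi> ` G)) \<phi>"
proof -
  let ?G = "generated_subalgebra G" and ?H = "generated_subalgebra (\<phi> ` G)"
  have G: "is_subalgebra ?G" and H: "is_subalgebra ?H"
    by (rule is_subalgebra_generated)+
  have GA: "?G \<subseteq> A"
    using A by (intro generated_subalgebra_subset)
  have "?G \<subseteq> {f \<in> A. \<phi> f \<in> ?H}"
  proof (rule generated_subalgebra_subset)
    show "is_subalgebra {f \<in> A. \<phi> f \<in> ?H}"
      using A(1) H assms(4-6) by (simp add: is_subalgebra_def)
  qed (use A(2) in \<open>auto intro: generator_in_generated\<close>)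
  moreover have "?H \<subseteq> \<phi> ` ?G"
  proof (rule generated_subalgebra_subset)
    have "f + g \<in> \<phi> ` ?G \<and> f * g \<in> \<phi> ` ?G" if "f \<in> \<phi> ` ?G" "g \<in> \<phi> ` ?G" for f g
    proof -
      from that obtain f' g' where fg: "f = \<phi> f'" "g = \<phi> g'" "f' \<in> ?G" "g' \<in> ?G"
        by blast
      moreover from this have "f' \<in> A" "g' \<in> A"
        using GA by blast+
      ultimately have "f + g = \<phi> (f' + g')" "f * g = \<phi> (f' * g')"
        using assms(5) mult by auto
      then show ?thesis
        using G fg(3,4) by (auto simp: is_subalgebra_def)
    qed
    moreover have "Const c \<in> \<phi> ` ?G" for c
      using G assms(4)[of c] by (metis image_eqI is_subalgebra_def)
    ultimately show "is_subalgebra (\<phi> ` ?G)"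
      by (auto simp: is_subalgebra_def)
  qed (auto intro: generator_in_generated)
  ultimately have "\<phi> ` ?G = ?H"
    by blast
  then show ?thesis
    using assms(3-5) mult subsetD[OF GA]
    by (auto simp: algebra_iso_on_def bij_betw_def inj_on_def inj_def)
qed

lemma chain_algebra_iso:
  assumes card: "\<And>C :: 'p::{finite,order} set. C \<in> maximal_chains \<Longrightarrow> card C = d" and "d > 0"
  shows "\<exists>\<phi> :: ('p, 'k::field) mpoly \<Rightarrow> ('p graded_var, 'k) mpoly.
    algebra_iso_on chain_algebra graded_chain_algebra \<phi> \<and>
    (\<forall>C \<in> maximal_chains. \<phi> (chain_monomial C) = graded_chain_monomial C)"
proof -
  let ?\<phi> = "map_exponents (graded_exponent d) :: ('p, 'k) mpoly \<Rightarrow> ('p graded_var, 'k) mpoly"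
  define A where "A = {f :: ('p, 'k) mpoly. \<forall>m\<in>Poly_Mapping.keys f. d dvd total_degree m}"
  have image: "?\<phi> (chain_monomial C) = graded_chain_monomial C" if "C \<in> maximal_chains" for C
    using graded_exponent_indicator[OF card[OF that] \<open>d > 0\<close>]
    by (simp add: chain_monomial_single graded_chain_monomial_single)
  have "algebra_iso_on (generated_subalgebra (chain_monomial ` maximal_chains))
      (generated_subalgebra (?\<phi> ` chain_monomial ` maximal_chains)) ?\<phi>"
  proof (rule algebra_iso_on_generated)
    have "f + g \<in> A \<and> f * g \<in> A" if "f \<in> A" "g \<in> A" for f g
      using that keys_add[of f g] keys_mult[of f g]
      by (fastforce simp: A_def total_degree_add)
    moreover have "Const c \<in> A" for c
      by (simp add: A_def Const_def total_degree_def)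
    ultimately show "is_subalgebra A"
      by (simp add: is_subalgebra_def)
    show "chain_monomial ` maximal_chains \<subseteq> A"
      using card by (auto simp: A_def chain_monomial_single total_degree_indicator simp del: One_nat_def)
    show "?\<phi> (f * g) = ?\<phi> f * ?\<phi> g" if "f \<in> A" "g \<in> A" for f g
      using that by (intro map_exponents_mult graded_exponent_add) (auto simp: A_def)
    show "?\<phi> (Const c) = Const c" for c
      by (simp add: Const_def graded_exponent_def total_degree_def)
  qed (simp_all add: map_exponents_add inj_map_exponents inj_graded_exponent)
  also have "?\<phi> ` chain_monomial ` maximal_chains = graded_chain_monomial ` maximal_chains"
    using image by (simp add: image_image)
  finally show ?thesis
    using image unfolding chain_algebra_def graded_chain_algebra_def by blast
qed

lemma prod_graded_chain_monomial:
  fixes C :: "'i \<Rightarrow> 'p::finite set"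
  assumes "finite I"
  shows "(\<Prod>i\<in>I. graded_chain_monomial (C i) :: ('p graded_var, 'k::field) mpoly) =
    (\<Prod>x\<in>UNIV. Var (Coord x) ^ (\<Sum>i\<in>I. indicator (C i) x)) * Var Grading ^ card I"
proof -
  have "(\<Prod>x\<in>C i. f x) = (\<Prod>x\<in>UNIV. f x ^ indicator (C i) x)"
    for f :: "'p \<Rightarrow> ('p graded_var, 'k) mpoly" and i
    by (rule prod.mono_neutral_cong_left) (auto simp: indicator_def)
  then show ?thesis
    by (simp add: graded_chain_monomial_def prod.distrib power_sum prod.swap[of _ I])
qed

lemma graded_chain_algebra_eq_ehrhart_ring:
  assumes pure: "pure_poset TYPE('p::{finite,order}) r"
  shows "(graded_chain_algebra :: ('p graded_var, 'k::field) mpoly set) = ehrhart_ring chain_polytope"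
proof
  let ?mon = "\<lambda>a k. (\<Prod>x\<in>UNIV. Var (Coord x) ^ a x) * Var Grading ^ k :: ('p graded_var, 'k) mpoly"
  let ?gens = "{?mon a k | a k. (\<chi> x. real (a x)) \<in> dilate k chain_polytope}"
  show "(graded_chain_algebra :: ('p graded_var, 'k) mpoly set) \<subseteq> ehrhart_ring chain_polytope"
    unfolding graded_chain_algebra_def
  proof (rule generated_subalgebra_subset)
    show "graded_chain_monomial ` maximal_chains \<subseteq>
      (ehrhart_ring chain_polytope :: ('p graded_var, 'k) mpoly set)"
    proof (rule image_subsetI)
      fix C :: "'p set" assume "C \<in> maximal_chains"
      then have "(\<chi> x. real (indicator C x)) \<in> dilate 1 chain_polytope"
        using indicator_mem_chain_polytope[of C] by (simp add: dilate_def indicator_def)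
      moreover have "graded_chain_monomial C = ?mon (indicator C) 1"
        using prod_graded_chain_monomial[of "{()}" "\<lambda>_. C"] by simp
      ultimately have "graded_chain_monomial C \<in> ?gens"
        by blast
      then show "(graded_chain_monomial C :: ('p graded_var, 'k) mpoly) \<in> ehrhart_ring chain_polytope"
        unfolding ehrhart_ring_def by (rule generator_in_generated)
    qed
  qed (simp add: ehrhart_ring_def is_subalgebra_generated)
  show "ehrhart_ring chain_polytope \<subseteq> (graded_chain_algebra :: ('p graded_var, 'k) mpoly set)"
    unfolding ehrhart_ring_def
  proof (rule generated_subalgebra_subset)
    show "?gens \<subseteq> graded_chain_algebra"
    proof clarify
      fix a :: "'p \<Rightarrow> nat" and k
      assume "(\<chi> x. real (a x)) \<in> dilate k chain_polytope"
      then obtain C where C: "\<And>i. i < k \<Longrightarrow> C i \<in> maximal_chains"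
        "\<And>x. a x = (\<Sum>i<k. indicator (C i) x)"
        using chain_decomposition[OF pure] by metis
      have "?mon a k = (\<Prod>i<k. graded_chain_monomial (C i))"
        by (simp add: prod_graded_chain_monomial C(2))
      also have "\<dots> \<in> graded_chain_algebra"
        unfolding graded_chain_algebra_def
        using C(1) by (intro is_subalgebra_prod is_subalgebra_generated generator_in_generated) auto
      finally show "?mon a k \<in> graded_chain_algebra" .
    qed
  qed (simp add: graded_chain_algebra_def is_subalgebra_generated)
qed

theorem proposition4p1:
  fixes r :: nat
  assumes "pure_poset TYPE('p::{finite,order}) r"
  shows "integer_decomposition_property (chain_polytope :: (real ^ 'p::{finite,order}) set) \<and>
    (\<exists>\<phi> :: ('p, 'k::field) mpoly \<Rightarrow> ('p graded_var, 'k) mpoly.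
       algebra_iso_on chain_algebra graded_chain_algebra \<phi> \<and>
       (\<forall>C \<in> maximal_chains. \<phi> (chain_monomial C) = graded_chain_monomial C)) \<and>
    (graded_chain_algebra :: ('p graded_var, 'k) mpoly set) = ehrhart_ring chain_polytope"
  using integer_decomposition_property_chain_polytope[OF assms]
    chain_algebra_iso[OF card_maximal_chain[OF assms]]
    graded_chain_algebra_eq_ehrhart_ring[OF assms]
  by simp

end
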